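(* Let $\theta>2$. The randomized preemptive online algorithm $\mathcal{A}_\theta$ for maximum weight matching described in the context achieves an expected competitive ratio of $\frac{2\theta\ln\theta}{\theta-2}$; that is, for every finite input sequence of edges with non-negative weights, if $M$ denotes the matching held by $\mathcal{A}_\theta$ at termination and $\mathrm{OPT}$ denotes the maximum weight of a matching in the input graph, then $$\frac{2\theta\ln\theta}{\theta-2}\cdot\mathbb{E}_\tau[w(M)]\ \ge\ \mathrm{OPT}.$$ Moreover, the equation $2(\ln\theta+1)=\theta$ has a unique solution $\theta^*$ over $(2,\infty)$, with $\theta^*\approx 5.356$; over $\theta\in(2,\infty)$ the ratio $\frac{2\theta\ln\theta}{\theta-2}$ is minimized at $\theta=\theta^*$, and its value there is $\theta^*$.
   Context: Preemptive online maximum weight matching: the edges of a finite simple undirected graph, each with a non-negative real weight $w(e)$, are presented one by one in a fixed order; the algorithm maintains a matching $M$, initially empty. When an edge is presented, the algorithm may remove edges from $M$ and must decide whether to add the new edge; rejected or removed edges can never be re-inserted. The objective is to maximize $w(M)=\sum_{e\in M}w(e)$ for the final $M$. Algorithm $\mathcal{A}_\theta$: before reading the input, draw $\tau$ uniformly at random from $(0,1]$ and set $\phi=\theta^\tau$. For an edge $e$ with $w(e)>0$, define its rounded weight $\tilde w(e)=\phi\theta^i$, where $i\in\mathbb{Z}$ is the unique integer with $w(e)\in[\phi\theta^i,\phi\theta^{i+1})$; if $w(e)=0$, set $\tilde w(e)=0$. Start with $M=\emptyset$. When an edge $e$ is presented, let $X(M,e)$ be the set of edges of $M$ sharing an endpoint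 with $e$. If every $e'\in X(M,e)$ satisfies $\tilde w(e')<\tilde w(e)$ (in particular, if $X(M,e)=\emptyset$), set $M\leftarrow (M\setminus X(M,e))\cup\{e\}$; otherwise $M$ is unchanged. The expectation $\mathbb{E}_\tau$ is over the random choice of $\tau$. *)

theory Defs
  imports "HOL-Analysis.Analysis"
begin

text \<open>A finite simple undirected graph, presented edge by edge: the edges are two-element sets
  of vertices, and no edge is presented twice.\<close>

definition edge_sequence :: "'a set list \<Rightarrow> bool" where
  "edge_sequence es \<longleftrightarrow> distinct es \<and> (\<forall>e\<in>set es. card e = 2)"

definition matching :: "'a set set \<Rightarrow> 'a set set \<Rightarrow> bool" where
  "matching E M \<longleftrightarrow> M \<subseteq> E \<and> (\<forall>e\<in>M. \<forall>f\<in>M. e \<noteq> f \<longrightarrow> e \<inter> f = {})"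

definition weight :: "('a set \<Rightarrow> real) \<Rightarrow> 'a set set \<Rightarrow> real" where
  "weight w M = (\<Sum>e\<in>M. w e)"

definition opt :: "'a set set \<Rightarrow> ('a set \<Rightarrow> real) \<Rightarrow> real" where
  "opt E w = Max {weight w M | M. matching E M}"

text \<open>Rounding of a weight \<open>x\<close> down to the grid of points \<open>\<phi> \<theta>\<^sup>i\<close> with \<open>i\<close> an integer.
  The description is proper whenever \<open>x > 0\<close>, \<open>\<phi> > 0\<close> and \<open>\<theta> > 1\<close>.\<close>

definition rounded :: "real \<Rightarrow> real \<Rightarrow> real \<Rightarrow> real" where
  "rounded \<theta> \<phi> x =
     (if x > 0
      then \<phi> * \<theta> powi (THE i::int. \<phi> * \<theta> powi i \<le> x \<and> x < \<phi> * \<theta> powi (i + 1))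
      else 0)"

definition conflicts :: "'a set set \<Rightarrow> 'a set \<Rightarrow> 'a set set" where
  "conflicts M e = {e' \<in> M. e' \<inter> e \<noteq> {}}"

definition step :: "('a set \<Rightarrow> real) \<Rightarrow> 'a set \<Rightarrow> 'a set set \<Rightarrow> 'a set set" where
  "step wr e M =
     (if \<forall>e'\<in>conflicts M e. wr e' < wr e then insert e (M - conflicts M e) else M)"

text \<open>The final matching of the algorithm with parameter \<open>\<theta>\<close> when the random draw is \<open>\<tau>\<close>.\<close>

definition alg :: "real \<Rightarrow> real \<Rightarrow> ('a set \<Rightarrow> real) \<Rightarrow> 'a set list \<Rightarrow> 'a set set" where
  "alg \<theta> \<tau> w es = fold (step (\<lambda>e. rounded \<theta> (\<theta> powr \<tau>) (w e))) es {}"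

definition tau_distr :: "real measure" where
  "tau_distr = uniform_measure lborel {0<..1}"

definition ratio :: "real \<Rightarrow> real" where
  "ratio \<theta> = 2 * \<theta> * ln \<theta> / (\<theta> - 2)"

end

theory Submission
  imports Defs
begin

text \<open>For a fixed draw, give every vertex \<open>v\<close> the largest rounded weight \<open>b v\<close> of an edge at \<open>v\<close>
  that was ever accepted. Every presented edge is dominated by \<open>b\<close> at one of its endpoints, so the
  rounded weight of any matching is at most the sum of \<open>b\<close>. Accepting \<open>e\<close> in place of the edges
  \<open>X\<close>, at most two and each lighter by a factor \<open>\<theta>\<close>, raises this sum by at most
  \<open>2 w e - w X\<close>, which is at most \<open>2 (\<theta> - 1) / (\<theta> - 2)\<close> times the growth of the
  rounded weight of \<open>M\<close>. Averaging over \<open>\<tau>\<close>, a weight loses exactly the factor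
  \<open>(\<theta> - 1) / (\<theta> ln \<theta>)\<close> through rounding. The ratio is minimized through the tangent
  inequality \<open>ln x \<le> x - 1\<close>.\<close>

section \<open>Rounding to the geometric grid\<close>

text \<open>Logarithms to base \<theta> turn the two bounds of a grid cell into the bounds that
  characterise a floor, which replaces the definite description by a closed form.\<close>

lemma rounded_powr:
  assumes "\<theta> > 1" "x > 0"
  shows "rounded \<theta> (\<theta> powr \<tau>) x = \<theta> powr (\<tau> + of_int \<lfloor>log \<theta> x - \<tau>\<rfloor>)"
proof -
  have powi: "\<theta> powr \<tau> * \<theta> powi i = \<theta> powr (\<tau> + of_int i)" for i :: int
    using assms by (simp add: powr_add powr_real_of_int')
  have x: "x = \<theta> powr (log \<theta> x)"
    using assms by simp
  have "\<theta> powr \<tau> * \<theta> powi i \<le> x \<and> x < \<theta> powr \<tau> * \<theta> powi (i + 1)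
      \<longleftrightarrow> \<tau> + of_int i \<le> log \<theta> x \<and> log \<theta> x < \<tau> + of_int (i + 1)" for i
    unfolding powi using assms by (simp add: le_log_iff log_less_iff)
  also have "(\<tau> + of_int i \<le> log \<theta> x \<and> log \<theta> x < \<tau> + of_int (i + 1))
      \<longleftrightarrow> i = \<lfloor>log \<theta> x - \<tau>\<rfloor>" for i
    by (auto simp: floor_eq_iff algebra_simps) linarith+
  finally show ?thesis
    using assms by (simp add: rounded_def powi)
qed

lemma rounded_nonneg: "\<theta> > 1 \<Longrightarrow> rounded \<theta> (\<theta> powr \<tau>) x \<ge> 0"
  by (cases "x > 0") (simp_all add: rounded_powr, simp add: rounded_def)

lemma rounded_le:
  assumes "\<theta> > 1" "x \<ge> 0"
  shows "rounded \<theta> (\<theta> powr \<tau>) x \<le> x"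
proof (cases "x > 0")
  case True
  have "\<theta> powr (\<tau> + of_int \<lfloor>log \<theta> x - \<tau>\<rfloor>) \<le> \<theta> powr (log \<theta> x)"
    using assms by (intro powr_mono) linarith+
  then show ?thesis
    using True assms by (simp add: rounded_powr)
next
  case False
  then show ?thesis using assms by (simp add: rounded_def)
qed

text \<open>All positive rounded weights of one draw share the offset \<tau> in the exponent, so two
  different ones have exponents at least 1 apart.\<close>

lemma rounded_gap:
  assumes "\<theta> > 1" "rounded \<theta> (\<theta> powr \<tau>) x < rounded \<theta> (\<theta> powr \<tau>) y"
  shows "\<theta> * rounded \<theta> (\<theta> powr \<tau>) x \<le> rounded \<theta> (\<theta> powr \<tau>) y"
proof (cases "x > 0")
  case True
  have "y > 0"
    using assms rounded_nonneg[of \<theta> \<tau> x] by (auto simp: rounded_def split: if_splits)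
  let ?i = "\<lfloor>log \<theta> x - \<tau>\<rfloor>" and ?j = "\<lfloor>log \<theta> y - \<tau>\<rfloor>"
  have "?i < ?j"
    using assms True \<open>y > 0\<close> by (simp add: rounded_powr)
  then have "\<theta> powr (1 + (\<tau> + of_int ?i)) \<le> \<theta> powr (\<tau> + of_int ?j)"
    using assms(1) by (intro powr_mono) linarith+
  then show ?thesis
    using assms(1) True \<open>y > 0\<close> by (simp add: rounded_powr powr_add)
next
  case False
  then show ?thesis
    using assms rounded_nonneg[of \<theta> \<tau> y] by (simp add: rounded_def)
qed

lemma rounded_measurable:
  assumes "\<theta> > 1"
  shows "(\<lambda>\<tau>. rounded \<theta> (\<theta> powr \<tau>) x) \<in> borel_measurable borel"
proof (cases "x > 0")
  case True
  then show ?thesis using assms by (simp add: rounded_powr)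
next
  case False
  then show ?thesis by (simp add: rounded_def)
qed

section \<open>Vertex charges for a fixed draw\<close>

text \<open>Induction over prefixes, with \<open>V\<close> fixed so that all sums of
  \<open>b\<close> run over the same vertices. Of the rounding only nonnegativity and the gap are
  used. The bound of \<open>b\<close> from below on the current matching is carried along because it
  limits the rise of \<open>b\<close> when edges are replaced.\<close>

lemma fold_step_invariant:
  fixes wr :: "'a set \<Rightarrow> real" and \<theta> :: real
  assumes "\<theta> > 2" and V: "finite V" "\<Union>(set es) \<subseteq> V" and card2: "\<forall>e\<in>set es. card e = 2"
    and nonneg: "\<And>e. wr e \<ge> 0"
    and gap: "\<And>e f. wr e < wr f \<Longrightarrow> \<theta> * wr e \<le> wr f"
  defines "c \<equiv> 2 * (\<theta> - 1) / (\<theta> - 2)"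
  shows "matching (set es) (fold (step wr) es {}) \<and> (\<exists>b. (\<forall>v. b v \<ge> 0)
    \<and> (\<forall>m\<in>fold (step wr) es {}. \<forall>v\<in>m. wr m \<le> b v)
    \<and> (\<forall>f\<in>set es. \<exists>v\<in>f. wr f \<le> b v) \<and> sum b V \<le> c * sum wr (fold (step wr) es {}))"
  using V(2) card2
proof (induction es rule: rev_induct)
  case Nil
  show ?case
    by (intro conjI exI[of _ "\<lambda>_. 0"]) (auto simp: matching_def)
next
  case (snoc e es)
  define M where "M = fold (step wr) es {}"
  define X where "X = conflicts M e"
  have IH: "matching (set es) M \<and> (\<exists>b. (\<forall>v. b v \<ge> 0) \<and> (\<forall>m\<in>M. \<forall>v\<in>m. wr m \<le> b v)
    \<and> (\<forall>f\<in>set es. \<exists>v\<in>f. wr f \<le> b v) \<and> sum b V \<le> c * sum wr M)"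
    unfolding M_def by (rule snoc.IH) (use snoc.prems in auto)
  then have M: "matching (set es) M"
    by (rule conjunct1)
  obtain b where b: "(\<forall>v. b v \<ge> 0) \<and> (\<forall>m\<in>M. \<forall>v\<in>m. wr m \<le> b v)
    \<and> (\<forall>f\<in>set es. \<exists>v\<in>f. wr f \<le> b v) \<and> sum b V \<le> c * sum wr M"
    using IH by (elim conjE[of "matching _ _"] exE)
  have b0: "b v \<ge> 0" and bM: "m \<in> M \<Longrightarrow> v \<in> m \<Longrightarrow> wr m \<le> b v"
    and bf: "f \<in> set es \<Longrightarrow> \<exists>v\<in>f. wr f \<le> b v" and bV: "sum b V \<le> c * sum wr M" for m v f
    using b by simp_all
  have step_eq: "fold (step wr) (es @ [e]) {} = step wr e M"
    by (simp add: M_def)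
  show ?case
  proof (cases "\<forall>e'\<in>X. wr e' < wr e")
    case False
    then have eq: "step wr e M = M"
      unfolding step_def X_def by (rule if_not_P)
    \<comment> \<open>The edge \<open>a\<close> that blocks \<open>e\<close> already forces
      \<open>b\<close> to dominate \<open>e\<close> at their common vertex, so \<open>b\<close> can
      stay as it is.\<close>
    from False obtain a v where a: "a \<in> M" "v \<in> a" "v \<in> e" "wr e \<le> wr a"
      by (auto simp: X_def conflicts_def not_less)
    then have "\<exists>v\<in>e. wr e \<le> b v"
      using bM order_trans by blast
    then show ?thesis
      unfolding step_eq eq using M b0 bM bf bV
      by (intro conjI exI[of _ b]) (auto simp: matching_def)
  next
    case True
    then have eq: "step wr e M = insert e (M - X)"
      unfolding step_def X_def by (rule if_P)
    \<comment> \<open>Taking the maximum keeps old edges dominated, including those that now leave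
      the matching.\<close>
    define b' where "b' v = (if v \<in> e then max (b v) (wr e) else b v)" for v
    have e: "card e = 2" "e \<subseteq> V" "finite e" "e \<noteq> {}"
      using snoc.prems by (auto intro: card_ge_0_finite)
    have finM: "finite M"
      using M finite_subset by (auto simp: matching_def)
    have X: "X \<subseteq> M" "finite X"
      using finM by (auto simp: X_def conflicts_def)
    have disj: "a \<inter> a' = {}" if "a \<in> M" "a' \<in> M" "a \<noteq> a'" for a a'
      using M that by (auto simp: matching_def)
    \<comment> \<open>Charging each removed edge to a vertex it shares with \<open>e\<close>\<close>
    define p where "p a = (SOME v. v \<in> a \<inter> e)" for a
    have p: "p a \<in> a" "p a \<in> e" if "a \<in> X" for a
      using that someI_ex[of "\<lambda>v. v \<in> a \<inter> e"] by (auto simp: X_def conflicts_def p_def)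
    have inj: "inj_on p X"
      using p disj X by (intro inj_onI) (metis IntI empty_iff subsetD)
    have pX: "p ` X \<subseteq> e"
      using p by auto
    have "card X \<le> 2"
      using card_inj_on_le[OF inj pX] e by simp
    moreover have "wr a \<le> wr e / \<theta>" if "a \<in> X" for a
      using gap[of a e] True that \<open>\<theta> > 2\<close> by (simp add: field_simps)
    ultimately have "sum wr X \<le> 2 * (wr e / \<theta>)"
      using sum_bounded_above[of X wr "wr e / \<theta>"] nonneg[of e] \<open>\<theta> > 2\<close>
        mult_right_mono[of "real (card X)" 2 "wr e / \<theta>"] by simp
    then have small: "\<theta> * sum wr X \<le> 2 * wr e"
      using \<open>\<theta> > 2\<close> by (simp add: field_simps)
    have "sum b' V - sum b V = (\<Sum>v\<in>V. b' v - b v)"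
      by (simp add: sum_subtractf)
    also have "\<dots> = (\<Sum>v\<in>e. b' v - b v)"
      using e V(1) by (intro sum.mono_neutral_right) (auto simp: b'_def)
    also have "\<dots> = (\<Sum>v\<in>p ` X. b' v - b v) + (\<Sum>v\<in>e - p ` X. b' v - b v)"
      using sum.subset_diff[OF pX \<open>finite e\<close>, of "\<lambda>v. b' v - b v"] by simp
    \<comment> \<open>At a charged endpoint \<open>b\<close> was already at least the weight of the
      removed edge; at the other endpoints only nonnegativity of \<open>b\<close> is
      available.\<close>
    also have "(\<Sum>v\<in>p ` X. b' v - b v) \<le> (\<Sum>a\<in>X. wr e - wr a)"
      unfolding sum.reindex[OF inj] o_def
    proof (rule sum_mono)
      fix a assume a: "a \<in> X"
      then have "wr a \<le> b (p a)" "wr a < wr e"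
        using bM p X True by auto
      then show "b' (p a) - b (p a) \<le> wr e - wr a"
        using b0[of "p a"] by (auto simp: b'_def max_def)
    qed
    also have "(\<Sum>v\<in>e - p ` X. b' v - b v) \<le> (\<Sum>v\<in>e - p ` X. wr e)"
      using b0 nonneg by (intro sum_mono) (auto simp: b'_def max_def)
    also have "(\<Sum>a\<in>X. wr e - wr a) + (\<Sum>v\<in>e - p ` X. wr e) = 2 * wr e - sum wr X"
      using card_Diff_subset[OF _ pX] card_image[OF inj] \<open>card X \<le> 2\<close> X e
      by (simp add: sum_subtractf of_nat_diff algebra_simps)
    finally have inc: "sum b' V - sum b V \<le> 2 * wr e - sum wr X"
      by simp
    \<comment> \<open>This says that \<open>2 * wr e - sum wr X\<close> is at most \<open>c\<close>
      times the gain \<open>wr e - sum wr X\<close>. The constant \<open>c\<close> makes it exactly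
      \<open>small\<close> divided by \<theta> - 2.\<close>
    have "(c - 1) * sum wr X \<le> (c - 2) * wr e"
    proof -
      have "c - 1 = \<theta> / (\<theta> - 2)" "c - 2 = 2 / (\<theta> - 2)"
        using \<open>\<theta> > 2\<close> by (simp_all add: c_def field_simps)
      then show ?thesis
        using small \<open>\<theta> > 2\<close> by (simp add: divide_right_mono)
    qed
    moreover have "e \<notin> M - X"
      using e by (auto simp: X_def conflicts_def)
    then have sum_eq: "sum wr (insert e (M - X)) = wr e + (sum wr M - sum wr X)"
      using finM X by (simp add: sum_diff)
    ultimately have "sum b' V \<le> c * sum wr (insert e (M - X))"
      unfolding sum_eq using inc bV by (simp add: algebra_simps)
    moreover have "\<exists>v\<in>f. wr f \<le> b' v" if "f \<in> set (es @ [e])" for f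
    proof (cases "f = e")
      case True
      then show ?thesis using e by (auto simp: b'_def)
    next
      case False
      then have "f \<in> set es"
        using that by simp
      then obtain v where "v \<in> f" "wr f \<le> b v"
        using bf by blast
      then show ?thesis by (intro bexI[of _ v]) (auto simp: b'_def)
    qed
    moreover have "wr m \<le> b' v" if "m \<in> insert e (M - X)" "v \<in> m" for m v
      using that bM[of m v] by (auto simp: b'_def)
    moreover have "b' v \<ge> 0" for v
      using b0[of v] by (auto simp: b'_def)
    moreover have "matching (set (es @ [e])) (insert e (M - X))"
      using M by (auto simp: matching_def X_def conflicts_def)
    ultimately show ?thesis
      unfolding step_eq eq by blast
  qed
qed

text \<open>Disjoint edges of \<open>N\<close> choose distinct dominating endpoints, so their
  rounded weights fit into the sum of \<open>b\<close>. On the side of the algorithm rounding down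
  is simply undone by \<open>rounded_le\<close>, so the rounding loss is paid only on
  \<open>N\<close>.\<close>

lemma matching_rounded_le:
  assumes "\<theta> > 2" "edge_sequence es" "matching (set es) N"
    and w: "\<forall>e\<in>set es. w e \<ge> 0"
  shows "(\<Sum>f\<in>N. rounded \<theta> (\<theta> powr \<tau>) (w f))
    \<le> 2 * (\<theta> - 1) / (\<theta> - 2) * weight w (alg \<theta> \<tau> w es)"
proof -
  define wr where "wr f = rounded \<theta> (\<theta> powr \<tau>) (w f)" for f
  define V where "V = \<Union>(set es)"
  define c where "c = 2 * (\<theta> - 1) / (\<theta> - 2)"
  let ?M = "alg \<theta> \<tau> w es"
  have card2: "\<forall>e\<in>set es. card e = 2"
    using assms by (simp add: edge_sequence_def)
  then have finV: "finite V"
    unfolding V_def by (metis List.finite_set card.infinite finite_Union zero_neq_numeral)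
  have M_eq: "?M = fold (step wr) es {}"
    by (simp add: alg_def wr_def[abs_def])
  have inv: "matching (set es) ?M \<and> (\<exists>b. (\<forall>v. b v \<ge> 0) \<and> (\<forall>m\<in>?M. \<forall>v\<in>m. wr m \<le> b v)
    \<and> (\<forall>f\<in>set es. \<exists>v\<in>f. wr f \<le> b v) \<and> sum b V \<le> c * sum wr ?M)"
    unfolding M_eq c_def using \<open>\<theta> > 2\<close> finV card2
    by (intro fold_step_invariant) (auto simp: V_def wr_def rounded_nonneg rounded_gap)
  then have M: "matching (set es) ?M"
    by (rule conjunct1)
  obtain b where b: "(\<forall>v. b v \<ge> 0) \<and> (\<forall>m\<in>?M. \<forall>v\<in>m. wr m \<le> b v)
    \<and> (\<forall>f\<in>set es. \<exists>v\<in>f. wr f \<le> b v) \<and> sum b V \<le> c * sum wr ?M"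
    using inv by (elim conjE[of "matching _ _"] exE)
  have b0: "b v \<ge> 0" and bf: "f \<in> set es \<Longrightarrow> \<exists>v\<in>f. wr f \<le> b v"
    and bV: "sum b V \<le> c * sum wr ?M" for v f
    using b by simp_all
  have N: "N \<subseteq> set es" "finite N"
    using assms(3) finite_subset by (auto simp: matching_def)
  obtain p where p: "\<And>f. f \<in> N \<Longrightarrow> p f \<in> f \<and> wr f \<le> b (p f)"
    using bf N by (metis subsetD)
  have "inj_on p N"
    using p assms(3) unfolding matching_def by (intro inj_onI) (metis IntI empty_iff)
  then have "sum b (p ` N) = (\<Sum>f\<in>N. b (p f))"
    by (simp add: sum.reindex)
  moreover have "sum wr N \<le> (\<Sum>f\<in>N. b (p f))"
    using p by (intro sum_mono) auto
  moreover have "sum b (p ` N) \<le> sum b V"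
    using p N b0 finV by (intro sum_mono2) (auto simp: V_def)
  moreover have "sum wr ?M \<le> weight w ?M"
    unfolding weight_def using M w \<open>\<theta> > 2\<close>
    by (intro sum_mono) (auto simp: wr_def matching_def intro!: rounded_le)
  then have "c * sum wr ?M \<le> c * weight w ?M"
    using \<open>\<theta> > 2\<close> by (intro mult_left_mono) (auto simp: c_def)
  ultimately show ?thesis
    using bV unfolding c_def wr_def by linarith
qed

section \<open>Measurability and integrability of the outcome\<close>

lemma tau_distr_density: "tau_distr = density lborel (\<lambda>\<tau>. ennreal (indicator {0<..1} \<tau>))"
  by (simp add: tau_distr_def uniform_measure_def ennreal_indicator divide_ennreal_def)

lemma sets_tau_distr [simp]: "sets tau_distr = sets borel"
  by (simp add: tau_distr_def)

lemma finite_measure_tau_distr: "finite_measure tau_distr"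
  by (rule finite_measureI) (simp add: tau_distr_def)

text \<open>The outcome takes finitely many values, and each step depends on \<tau> only through
  finitely many comparisons of measurable rounded weights.\<close>

lemma alg_in_Pow_measurable:
  fixes w :: "'a set \<Rightarrow> real"
  assumes "\<theta> > 1"
  shows "alg \<theta> \<tau> w es \<in> Pow (set es)"
    and "{\<tau>. alg \<theta> \<tau> w es = N} \<in> sets borel"
proof -
  define wr where "wr \<tau> f = rounded \<theta> (\<theta> powr \<tau>) (w f)" for \<tau> f
  have alg_eq: "alg \<theta> \<tau> w es = fold (step (wr \<tau>)) es {}" for \<tau> es
    by (simp add: alg_def wr_def[abs_def])
  have meas [measurable]: "(\<lambda>\<tau>. wr \<tau> f) \<in> borel_measurable borel" for f
    using assms by (simp add: wr_def rounded_measurable)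
  have sub: "alg \<theta> \<tau> w es \<subseteq> set es" for \<tau> es
    unfolding alg_eq by (induction es rule: rev_induct) (auto simp: step_def conflicts_def)
  then show "alg \<theta> \<tau> w es \<in> Pow (set es)"
    by simp
  show "{\<tau>. alg \<theta> \<tau> w es = N} \<in> sets borel"
  proof (induction es arbitrary: N rule: rev_induct)
    case Nil
    then show ?case by (cases "N = {}") (auto simp: alg_def)
  next
    case (snoc e es)
    have step: "{\<tau>. step (wr \<tau>) e M = N} \<in> sets borel" if "finite M" for M
    proof -
      have "finite (conflicts M e)"
        using that by (simp add: conflicts_def)
      then have "{\<tau> \<in> space borel. \<forall>e'\<in>conflicts M e. wr \<tau> e' < wr \<tau> e} \<in> sets borel"
        by measurable
      then have P: "Measurable.pred borel (\<lambda>\<tau>. \<forall>e'\<in>conflicts M e. wr \<tau> e' < wr \<tau> e)"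
        by (simp add: pred_def)
      have "{\<tau> \<in> space borel. if \<forall>e'\<in>conflicts M e. wr \<tau> e' < wr \<tau> e
          then insert e (M - conflicts M e) = N else M = N} \<in> sets borel"
        using P by measurable
      then show ?thesis
        by (simp add: step_def if_distrib[of "\<lambda>x. x = N"] cong: if_cong)
    qed
    \<comment> \<open>Splitting by the matching \<open>M\<close> held before the last edge leaves a
      step from a constant matching.\<close>
    have "{\<tau>. alg \<theta> \<tau> w (es @ [e]) = N}
        = (\<Union>M\<in>Pow (set es). {\<tau>. alg \<theta> \<tau> w es = M} \<inter> {\<tau>. step (wr \<tau>) e M = N})"
      using sub by (auto simp: alg_eq)
    also have "\<dots> \<in> sets borel"
      using snoc.IH by (intro sets.finite_UN sets.Int step) (auto intro: finite_subset)
    finally show ?case .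
  qed
qed

text \<open>As a function of \<tau> the final weight is a finite combination of indicators of Borel
  sets, and the measure is finite.\<close>

lemma integrable_weight_alg:
  fixes w :: "'a set \<Rightarrow> real"
  assumes "\<theta> > 1"
  shows "integrable tau_distr (\<lambda>\<tau>. weight w (alg \<theta> \<tau> w es))"
proof -
  interpret finite_measure tau_distr
    by (rule finite_measure_tau_distr)
  have eq: "weight w (alg \<theta> \<tau> w es)
      = (\<Sum>M\<in>Pow (set es). weight w M * indicator {\<tau>. alg \<theta> \<tau> w es = M} \<tau>)" for \<tau>
    using alg_in_Pow_measurable(1)[OF assms, of \<tau> w es]
    by (simp add: indicator_def sum.delta' if_distrib[of "\<lambda>x. _ * x"] cong: if_cong)
  have "{\<tau>. alg \<theta> \<tau> w es = M} \<in> sets tau_distr" for M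
    using alg_in_Pow_measurable(2)[OF assms, of w es M] by simp
  then show ?thesis
    unfolding eq
    by (intro Bochner_Integration.integrable_sum integrable_mult_right integrable_real_indicator)
       (auto simp: less_top[symmetric])
qed

section \<open>Expected loss through rounding\<close>

text \<open>As \<tau> runs through (0,1], the base-\<theta> logarithm of rounded weight over
  \<open>x\<close> runs once through (-1,0], whatever \<open>x > 0\<close> is. The mean factor is
  therefore the integral of \<open>\<theta> powr s\<close> over that interval.\<close>

lemma has_bochner_integral_rounded:
  assumes "\<theta> > 1" "x \<ge> 0"
  shows "has_bochner_integral tau_distr (\<lambda>\<tau>. rounded \<theta> (\<theta> powr \<tau>) x) (x * (\<theta> - 1) / (\<theta> * ln \<theta>))"
proof (cases "x = 0")
  case True
  then show ?thesis by (simp add: rounded_def has_bochner_integral_zero)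
next
  case False
  with assms have "x > 0" by simp
  \<comment> \<open>The exponent of the rounded weight drops from \<open>n\<close> to \<open>n - 1\<close> as \<open>\<tau>\<close> passes \<open>r\<close>.\<close>
  define n r where "n = \<lfloor>log \<theta> x\<rfloor>" and "r = frac (log \<theta> x)"
  have r: "0 \<le> r" "r < 1" and L: "log \<theta> x = of_int n + r"
    by (simp_all add: n_def r_def frac_lt_1) (simp add: frac_def) 
  define F where "F k t = \<theta> powr (t + of_int k) / ln \<theta>" for k :: int and t :: real
  have piece: "has_bochner_integral lborel (\<lambda>t. \<theta> powr (t + of_int k) * indicator {a..b} t) (F k b - F k a)"
    if "a \<le> b" for k a b
    unfolding F_def using assms that
    by (intro has_bochner_integral_FTC_Icc_real)
       (auto intro!: derivative_eq_intros continuous_intros)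
  have "has_bochner_integral lborel (\<lambda>t. \<theta> powr (t + of_int n) * indicator {0..r} t
      + \<theta> powr (t + of_int (n - 1)) * indicator {r..1} t) ((F n r - F n 0) + (F (n-1) 1 - F (n-1) r))"
    using r by (intro has_bochner_integral_add piece) auto
  \<comment> \<open>\<open>F n 0\<close> and \<open>F (n-1) 1\<close> cancel; what remains is
    \<open>x / ln \<theta>\<close> minus its \<theta>-th part.\<close>
  also have "(F n r - F n 0) + (F (n-1) 1 - F (n-1) r) = x * (\<theta> - 1) / (\<theta> * ln \<theta>)"
  proof -
    have "\<theta> powr (r + of_int n) = x"
      using L assms \<open>x > 0\<close> by (metis add.commute powr_log_cancel less_trans zero_less_one less_numeral_extra(4) order_less_irrefl)
    moreover have "\<theta> powr (r + of_int (n - 1)) = \<theta> powr (r + of_int n) / \<theta>"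
      using assms by (simp add: powr_diff add_diff_eq)
    ultimately show ?thesis
      using assms by (simp add: F_def field_simps)
  qed
  finally have split: "has_bochner_integral lborel (\<lambda>t. \<theta> powr (t + of_int n) * indicator {0..r} t
      + \<theta> powr (t + of_int (n - 1)) * indicator {r..1} t) (x * (\<theta> - 1) / (\<theta> * ln \<theta>))" .
  \<comment> \<open>The closed pieces overlap at \<open>r\<close> and include 0, which the draw
    excludes; leaving out these two points gives an exact identity.\<close>
  have ae: "AE t in lborel. \<theta> powr (t + of_int n) * indicator {0..r} t
      + \<theta> powr (t + of_int (n - 1)) * indicator {r..1} t
      = indicator {0<..1} t *\<^sub>R rounded \<theta> (\<theta> powr t) x"
    using AE_lborel_singleton[of 0] AE_lborel_singleton[of r]
  proof eventually_elim
    case (elim t)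
    have "\<lfloor>log \<theta> x - t\<rfloor> = n" if "0 < t" "t < r"
      using that r L by (simp add: floor_eq_iff)
    moreover have "\<lfloor>log \<theta> x - t\<rfloor> = n - 1" if "r < t" "t \<le> 1"
      using that r L by (simp add: floor_eq_iff)
    ultimately show ?case
      using elim r assms \<open>x > 0\<close> by (auto simp: indicator_def rounded_powr)
  qed
  have [measurable]: "(\<lambda>t. rounded \<theta> (\<theta> powr t) x) \<in> borel_measurable borel"
    using assms(1) by (rule rounded_measurable)
  show ?thesis
    unfolding tau_distr_density using has_bochner_integral_cong_AE[THEN iffD1, OF _ _ ae split]
    by (intro has_bochner_integral_density) auto
qed

section \<open>The competitive ratio\<close>

lemma opt_attained:
  assumes "finite E"
  obtains N where "matching E N" "opt E w = weight w N"
proof -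
  have "{weight w M | M. matching E M} = weight w ` {M. matching E M}"
    by auto
  moreover have "finite {M. matching E M}"
    using assms by (rule finite_subset[rotated, OF finite_Pow_iff[THEN iffD2]]) (auto simp: matching_def)
  moreover have "matching E {}"
    by (simp add: matching_def)
  ultimately have "opt E w \<in> weight w ` {M. matching E M}"
    unfolding opt_def by (metis Max_in empty_iff finite_imageI imageI mem_Collect_eq)
  then show ?thesis
    using that by auto
qed

text \<open>The pointwise bound is integrated for one optimal matching \<open>N\<close>, chosen
  independently of \<tau>, so that linearity of expectation applies to its rounded weight.\<close>

lemma opt_le_ratio_expectation:
  fixes w :: "'a set \<Rightarrow> real"
  assumes "\<theta> > 2" "edge_sequence es" and w: "\<forall>e\<in>set es. w e \<ge> 0"
  shows "opt (set es) w \<le> ratio \<theta> * (\<integral>\<tau>. weight w (alg \<theta> \<tau> w es) \<partial>tau_distr)"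
proof -
  define c where "c = 2 * (\<theta> - 1) / (\<theta> - 2)"
  obtain N where N: "matching (set es) N" and opt: "opt (set es) w = weight w N"
    using opt_attained[of "set es" w] by blast
  have "w f \<ge> 0" if "f \<in> N" for f
    using that N w by (auto simp: matching_def)
  then have "has_bochner_integral tau_distr (\<lambda>\<tau>. \<Sum>f\<in>N. rounded \<theta> (\<theta> powr \<tau>) (w f))
      (\<Sum>f\<in>N. w f * (\<theta> - 1) / (\<theta> * ln \<theta>))"
    using \<open>\<theta> > 2\<close> by (intro has_bochner_integral_sum has_bochner_integral_rounded) auto
  moreover have "(\<Sum>f\<in>N. w f * (\<theta> - 1) / (\<theta> * ln \<theta>)) = weight w N * (\<theta> - 1) / (\<theta> * ln \<theta>)"
    by (simp add: weight_def sum_distrib_right sum_divide_distrib)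
  ultimately have "integrable tau_distr (\<lambda>\<tau>. \<Sum>f\<in>N. rounded \<theta> (\<theta> powr \<tau>) (w f))"
    and eq: "(\<integral>\<tau>. (\<Sum>f\<in>N. rounded \<theta> (\<theta> powr \<tau>) (w f)) \<partial>tau_distr)
      = weight w N * (\<theta> - 1) / (\<theta> * ln \<theta>)"
    by (simp_all add: has_bochner_integral_iff)
  then have "(\<integral>\<tau>. (\<Sum>f\<in>N. rounded \<theta> (\<theta> powr \<tau>) (w f)) \<partial>tau_distr)
      \<le> (\<integral>\<tau>. c * weight w (alg \<theta> \<tau> w es) \<partial>tau_distr)"
    unfolding c_def using assms N
    by (intro integral_mono integrable_mult_right integrable_weight_alg matching_rounded_le) auto
  then have "weight w N * (\<theta> - 1) / (\<theta> * ln \<theta>)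
      \<le> c * (\<integral>\<tau>. weight w (alg \<theta> \<tau> w es) \<partial>tau_distr)"
    by (simp add: eq)
  moreover have "\<theta> * ln \<theta> / (\<theta> - 1) \<ge> 0"
    using \<open>\<theta> > 2\<close> by simp
  ultimately have "\<theta> * ln \<theta> / (\<theta> - 1) * (weight w N * (\<theta> - 1) / (\<theta> * ln \<theta>))
      \<le> \<theta> * ln \<theta> / (\<theta> - 1) * (c * (\<integral>\<tau>. weight w (alg \<theta> \<tau> w es) \<partial>tau_distr))"
    by (rule mult_left_mono)
  moreover have "ln \<theta> > 0"
    using \<open>\<theta> > 2\<close> by simp
  then have "\<theta> * ln \<theta> / (\<theta> - 1) * (weight w N * (\<theta> - 1) / (\<theta> * ln \<theta>)) = weight w N"
    using \<open>\<theta> > 2\<close> by simp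
  \<comment> \<open>The inverse rounding loss times the charging constant: the factor \<theta> - 1
    cancels.\<close>
  moreover have K: "\<theta> * ln \<theta> / (\<theta> - 1) * c = ratio \<theta>"
    using \<open>\<theta> > 2\<close> by (simp add: c_def ratio_def divide_simps)
  ultimately show ?thesis
    unfolding opt K[symmetric] by (simp only: mult.assoc)
qed

section \<open>The optimal parameter\<close>

text \<open>Follows from \<open>ln z < z - 1\<close> at \<open>z = y / x\<close>. The equation for
  the optimal parameter says that this function equals 2, so it has at most one solution above
  2.\<close>

lemma sub_two_ln_strict_mono:
  fixes x y :: real
  assumes "2 \<le> x" "x < y"
  shows "x - 2 * ln x < y - 2 * ln y"
proof -
  have "ln (y / x) < y / x - 1"
    using assms ln_less_self ln_eq_minus_one[of "y / x"] ln_le_minus_one[of "y / x"] by force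
  also have "\<dots> = (y - x) / x"
    using assms by (simp add: diff_divide_distrib)
  also have "\<dots> \<le> (y - x) / 2"
    using assms by (intro divide_left_mono) auto
  finally show ?thesis
    using assms by (simp add: ln_div)
qed

text \<open>Here 1.678 is 5.356 / 2 - 1, so an upper bound on \<open>exp 1.678\<close> is needed.
  Expanding at -1.678 to even order makes the remainder nonnegative, and the reciprocal turns the
  lower bound around.\<close>

lemma two_ln_5356_ge: "2 * (ln 5.356 + 1) \<ge> (5.356 :: real)"
proof -
  obtain t where "exp (-1.678 :: real) = (\<Sum>m<12. ((-1.678) ^ m) / fact m) + (exp t / fact 12) * (-1.678) ^ 12"
    using Maclaurin_exp_le[of "-1.678" 12] by blast
  moreover have "(exp t / fact 12) * (-1.678 :: real) ^ 12 \<ge> 0"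
    by (intro mult_nonneg_nonneg) auto
  moreover have "(\<Sum>m<12. ((-1.678 :: real) ^ m) / fact m) \<ge> 1 / 5.356"
    by (simp add: eval_nat_numeral fact_numeral)
  ultimately have "exp (-1.678 :: real) \<ge> 1 / 5.356"
    by linarith
  then have "exp (1.678 :: real) \<le> 5.356"
    by (simp add: exp_minus field_simps)
  then have "1.678 \<le> ln (5.356 :: real)"
    by (subst ln_ge_iff) auto
  then show ?thesis by simp
qed

text \<open>With 1.6785 = 5.357 / 2 - 1 a lower bound on the exponential is needed, which the
  truncated series gives directly.\<close>

lemma two_ln_5357_less: "2 * (ln 5.357 + 1) < (5.357 :: real)"
proof -
  obtain t where "exp (1.6785 :: real) = (\<Sum>m<12. (1.6785 ^ m) / fact m) + (exp t / fact 12) * 1.6785 ^ 12"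
    using Maclaurin_exp_le[of "1.6785" 12] by blast
  moreover have "(exp t / fact 12) * (1.6785 :: real) ^ 12 \<ge> 0"
    by (intro mult_nonneg_nonneg) auto
  moreover have "(\<Sum>m<12. ((1.6785 :: real) ^ m) / fact m) > 5.357"
    by (simp add: eval_nat_numeral fact_numeral)
  ultimately have "exp (1.6785 :: real) > 5.357"
    by linarith
  then have "ln (5.357 :: real) < 1.6785"
    using ln_less_cancel_iff[of "5.357" "exp 1.6785 :: real"] by simp
  then show ?thesis by simp
qed

lemma ratio_minimum:
  assumes "t > 2" "2 * (ln t + 1) = t"
  shows "ratio t = t" "\<theta> > 2 \<Longrightarrow> t \<le> ratio \<theta>"
proof -
  have "ratio t = t * (2 * ln t) / (t - 2)"
    by (simp add: ratio_def)
  also have "2 * ln t = t - 2"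
    using assms(2) by simp
  finally show "ratio t = t"
    using assms(1) by simp
  assume "\<theta> > 2"
  have "ln (t / \<theta>) \<le> t / \<theta> - 1"
    using assms \<open>\<theta> > 2\<close> by (intro ln_le_minus_one) auto
  then have "ln t + 1 - t / \<theta> \<le> ln \<theta>"
    using assms \<open>\<theta> > 2\<close> by (simp add: ln_div)
  \<comment> \<open>By the equation for \<open>t\<close> the left side equals
    \<open>t * (\<theta> - 2)\<close>, so dividing by \<theta> - 2 gives the claim.\<close>
  then have "2 * \<theta> * (ln t + 1 - t / \<theta>) \<le> 2 * \<theta> * ln \<theta>"
    using \<open>\<theta> > 2\<close> by (intro mult_left_mono) auto
  also have "2 * \<theta> * (ln t + 1 - t / \<theta>) = \<theta> * (2 * (ln t + 1)) - 2 * t"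
    using \<open>\<theta> > 2\<close> by (simp add: field_simps)
  finally show "t \<le> ratio \<theta>"
    unfolding assms(2) using \<open>\<theta> > 2\<close> by (simp add: ratio_def field_simps)
qed

theorem theorem3p7:
  shows "(\<forall>\<theta>::real. \<theta> > 2 \<longrightarrow>
            (\<forall>(es :: 'a set list) (w :: 'a set \<Rightarrow> real).
               edge_sequence es \<and> (\<forall>e\<in>set es. w e \<ge> 0) \<longrightarrow>
                 integrable tau_distr (\<lambda>\<tau>. weight w (alg \<theta> \<tau> w es)) \<and>
                 ratio \<theta> * (\<integral>\<tau>. weight w (alg \<theta> \<tau> w es) \<partial>tau_distr) \<ge> opt (set es) w))
       \<and> (\<exists>\<theta>s::real. \<theta>s > 2 \<and> 2 * (ln \<theta>s + 1) = \<theta>s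
            \<and> (\<forall>\<theta>>2. 2 * (ln \<theta> + 1) = \<theta> \<longrightarrow> \<theta> = \<theta>s)
            \<and> 5.356 \<le> \<theta>s \<and> \<theta>s < 5.357
            \<and> (\<forall>\<theta>>2. ratio \<theta>s \<le> ratio \<theta>)
            \<and> ratio \<theta>s = \<theta>s)"
proof (intro conjI)
  show "\<forall>\<theta>::real. \<theta> > 2 \<longrightarrow>
            (\<forall>(es :: 'a set list) (w :: 'a set \<Rightarrow> real).
               edge_sequence es \<and> (\<forall>e\<in>set es. w e \<ge> 0) \<longrightarrow>
                 integrable tau_distr (\<lambda>\<tau>. weight w (alg \<theta> \<tau> w es)) \<and>
                 ratio \<theta> * (\<integral>\<tau>. weight w (alg \<theta> \<tau> w es) \<partial>tau_distr) \<ge> opt (set es) w)"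
    by (auto intro: integrable_weight_alg opt_le_ratio_expectation)
  have "\<exists>t. 5.356 \<le> t \<and> t \<le> 5.357 \<and> t - 2 * ln t = (2 :: real)"
    using two_ln_5356_ge two_ln_5357_less
    by (intro IVT') (auto intro!: continuous_intros)
  then obtain t :: real where t: "5.356 \<le> t" "t \<le> 5.357" and eq: "2 * (ln t + 1) = t"
    by auto
  \<comment> \<open>The intermediate value theorem yields a closed interval; the strict bound at
    5.357 excludes its right end.\<close>
  have "t < 5.357"
    using t eq two_ln_5357_less by (cases "t = 5.357") auto
  moreover have "\<theta> = t" if "\<theta> > 2" "2 * (ln \<theta> + 1) = \<theta>" for \<theta>
    using that eq t sub_two_ln_strict_mono[of \<theta> t] sub_two_ln_strict_mono[of t \<theta>] by force
  moreover have "t > 2"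
    using t by simp
  moreover have "ratio t = t" "\<forall>\<theta>>2. ratio t \<le> ratio \<theta>"
    using ratio_minimum[OF \<open>t > 2\<close> eq] by simp_all
  ultimately show "\<exists>\<theta>s::real. \<theta>s > 2 \<and> 2 * (ln \<theta>s + 1) = \<theta>s
            \<and> (\<forall>\<theta>>2. 2 * (ln \<theta> + 1) = \<theta> \<longrightarrow> \<theta> = \<theta>s)
            \<and> 5.356 \<le> \<theta>s \<and> \<theta>s < 5.357
            \<and> (\<forall>\<theta>>2. ratio \<theta>s \<le> ratio \<theta>)
            \<and> ratio \<theta>s = \<theta>s"
    using t(1) eq by blast
qed

end
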